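(* Let $\mathscr{P}_{\mathrm f}(\mathbf{Z})$ be the collection of all finite subsets of $\mathbf{Z}$, with the action of $W(\mathbf{Z})$ given by $g\cdot E=g(E)$. There exists a $W(\mathbf{Z})$-invariant mean on $\mathscr{P}_{\mathrm f}(\mathbf{Z})$ which gives full weight (that is, weight $1$) to the collection $\{E\in\mathscr{P}_{\mathrm f}(\mathbf{Z}) : 0\in E\}$.
   Context: $W(\mathbf{Z})$ denotes the group (under composition) of all bijections $g\colon\mathbf{Z}\to\mathbf{Z}$ for which $|g|_{\mathrm w}:=\sup\{|g(j)-j| : j\in\mathbf{Z}\}$ is finite. A mean on a set $Y$ is a finitely additive probability measure defined on all subsets of $Y$; if a group $H$ acts on $Y$, the mean $\mathfrak m$ is invariant if $\mathfrak m(hA)=\mathfrak m(A)$ for all $h\in H$ and $A\subseteq Y$. *)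

theory Defs
  imports "HOL-Analysis.Analysis" "HOL-Algebra.Group_Action"
begin

text \<open>The supremum is taken in the extended naturals, so that it is \<open>\<infinity>\<close> exactly when the
  displacements are unbounded; a supremum over \<open>int\<close> or \<open>real\<close> would be unspecified there.\<close>

definition wobbling_norm :: "(int \<Rightarrow> int) \<Rightarrow> enat" where
  "wobbling_norm g = (SUP j. enat (nat \<bar>g j - j\<bar>))"

definition wobbling_group :: "(int \<Rightarrow> int) monoid" where
  "wobbling_group =
     \<lparr>carrier = {g. bij g \<and> wobbling_norm g < \<infinity>}, mult = (\<circ>), one = id\<rparr>"

text \<open>The restriction to \<open>Fpow UNIV\<close> makes each map extensional, as \<^const>\<open>BijGroup\<close> requires.\<close>

definition finite_set_action :: "(int \<Rightarrow> int) \<Rightarrow> int set \<Rightarrow> int set" where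
  "finite_set_action g = (\<lambda>E \<in> Fpow UNIV. g ` E)"

text \<open>Only the values of \<open>m\<close> on subsets of \<open>Y\<close> matter.\<close>

definition mean_on :: "'a set \<Rightarrow> ('a set \<Rightarrow> real) \<Rightarrow> bool" where
  "mean_on Y m \<longleftrightarrow> (\<forall>A\<subseteq>Y. 0 \<le> m A) \<and> m Y = 1 \<and> Measure_Space.additive (Pow Y) m"

definition invariant_mean ::
  "('g, 'r) monoid_scheme \<Rightarrow> 'a set \<Rightarrow> ('g \<Rightarrow> 'a \<Rightarrow> 'a) \<Rightarrow> ('a set \<Rightarrow> real) \<Rightarrow> bool" where
  "invariant_mean G Y \<phi> m \<longleftrightarrow>
     mean_on Y m \<and> (\<forall>g \<in> carrier G. \<forall>A\<subseteq>Y. m (\<phi> g ` A) = m A)"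

lemma wobbling_norm_finite_iff:
  "wobbling_norm g < \<infinity> \<longleftrightarrow> (\<exists>n. \<forall>j. \<bar>g j - j\<bar> \<le> int n)"
proof
  assume "wobbling_norm g < \<infinity>"
  then obtain n where n: "wobbling_norm g = enat n"
    by (cases "wobbling_norm g") auto
  have "\<bar>g j - j\<bar> \<le> int n" for j
  proof -
    have "enat (nat \<bar>g j - j\<bar>) \<le> enat n"
      unfolding n[symmetric] wobbling_norm_def by (rule SUP_upper) simp
    then show ?thesis by simp
  qed
  then show "\<exists>n. \<forall>j. \<bar>g j - j\<bar> \<le> int n" by blast
next
  assume "\<exists>n. \<forall>j. \<bar>g j - j\<bar> \<le> int n"
  then obtain n where n: "\<And>j. \<bar>g j - j\<bar> \<le> int n" by blast
  have "wobbling_norm g \<le> enat n"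
    unfolding wobbling_norm_def by (rule SUP_least) (use n in \<open>simp add: nat_le_iff\<close>)
  then show "wobbling_norm g < \<infinity>" using enat_ord_code(4) order_le_less_trans by blast
qed

lemma group_wobbling_group: "group wobbling_group"
proof (rule groupI)
  fix f g assume "f \<in> carrier wobbling_group" "g \<in> carrier wobbling_group"
  then obtain m n where mn: "bij f" "bij g" "\<And>j. \<bar>f j - j\<bar> \<le> int m" "\<And>j. \<bar>g j - j\<bar> \<le> int n"
    by (auto simp: wobbling_group_def wobbling_norm_finite_iff simp del: enat_ord_simps)
  have "\<bar>f (g j) - j\<bar> \<le> int (m + n)" for j
    using mn(3)[of "g j"] mn(4)[of j] by simp
  then show "f \<otimes>\<^bsub>wobbling_group\<^esub> g \<in> carrier wobbling_group"
    using mn(1,2) unfolding wobbling_group_def wobbling_norm_finite_iff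
    by (auto simp: bij_comp simp del: of_nat_add)
next
  show "\<one>\<^bsub>wobbling_group\<^esub> \<in> carrier wobbling_group"
    unfolding wobbling_group_def wobbling_norm_finite_iff by auto
next
  fix f assume "f \<in> carrier wobbling_group"
  then obtain m where m: "bij f" "\<And>j. \<bar>f j - j\<bar> \<le> int m"
    unfolding wobbling_group_def wobbling_norm_finite_iff by auto
  have "\<bar>inv_into UNIV f j - j\<bar> \<le> int m" for j
    using m(2)[of "inv_into UNIV f j"] m(1) by (simp add: bij_is_surj surj_f_inv_f abs_minus_commute)
  then have "inv_into UNIV f \<in> carrier wobbling_group"
    using m(1) unfolding wobbling_group_def wobbling_norm_finite_iff
    by (auto simp: bij_imp_bij_inv)
  moreover have "inv_into UNIV f \<otimes>\<^bsub>wobbling_group\<^esub> f = \<one>\<^bsub>wobbling_group\<^esub>"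
    using m(1) by (simp add: wobbling_group_def bij_is_inj)
  ultimately show "\<exists>g\<in>carrier wobbling_group. g \<otimes>\<^bsub>wobbling_group\<^esub> f = \<one>\<^bsub>wobbling_group\<^esub>"
    by blast
qed (auto simp: wobbling_group_def)

lemma finite_set_action_in_Bij:
  assumes "bij g"
  shows "finite_set_action g \<in> Bij (Fpow UNIV)"
proof -
  have "bij_betw (finite_set_action g) (Fpow UNIV) (Fpow UNIV)"
  proof (rule bij_betw_byWitness[where f' = "\<lambda>E. inv_into UNIV g ` E"])
    show "\<forall>E\<in>Fpow UNIV. inv_into UNIV g ` finite_set_action g E = E"
      using assms by (simp add: finite_set_action_def image_comp bij_is_inj)
    show "\<forall>E\<in>Fpow UNIV. finite_set_action g (inv_into UNIV g ` E) = E"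
      using assms by (auto simp: finite_set_action_def Fpow_def image_comp surj_iff[symmetric] bij_is_surj surj_f_inv_f)
  qed (auto simp: finite_set_action_def Fpow_def)
  then show ?thesis by (simp add: Bij_def finite_set_action_def)
qed

lemma group_action_finite_set_action:
  "group_action wobbling_group (Fpow UNIV) finite_set_action"
proof (intro group_action.intro group_hom.intro group_hom_axioms.intro homI)
  show "group wobbling_group" by (rule group_wobbling_group)
  show "group (BijGroup (Fpow UNIV :: int set set))" by (rule group_BijGroup)
next
  fix g assume "g \<in> carrier wobbling_group"
  then show "finite_set_action g \<in> carrier (BijGroup (Fpow UNIV))"
    by (simp add: wobbling_group_def BijGroup_def finite_set_action_in_Bij)
next
  fix f g assume "f \<in> carrier wobbling_group" "g \<in> carrier wobbling_group"
  then have "finite_set_action f \<in> Bij (Fpow UNIV)" "finite_set_action g \<in> Bij (Fpow UNIV)"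
    by (simp_all add: wobbling_group_def finite_set_action_in_Bij)
  then show "finite_set_action (f \<otimes>\<^bsub>wobbling_group\<^esub> g) =
      finite_set_action f \<otimes>\<^bsub>BijGroup (Fpow UNIV)\<^esub> finite_set_action g"
    by (auto simp: BijGroup_def wobbling_group_def compose_def finite_set_action_def Fpow_def
        fun_eq_iff image_comp)
qed

end

theory Submission
  imports Defs "HOL-Real_Asymp.Real_Asymp"
begin

text \<open>
  Choose a random finite set \<open>E\<close> by putting each \<open>j\<close> into \<open>E\<close> independently, with probability
  \<open>sin\<^sup>2 (\<theta> j)\<close> for a finitely supported field of angles \<open>\<theta>\<close>. Its law is the square of the vector
  with entries \<open>(\<Prod>j\<in>E. sin (\<theta> j)) * (\<Prod>j\<notin>E. cos (\<theta> j))\<close>, which is a tensor product of unit vectors of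
  the plane. Two such vectors, for the fields \<open>\<theta>\<close> and \<open>\<eta>\<close>, have inner product
  \<open>\<Prod>j. cos (\<theta> j - \<eta> j)\<close>, so the two laws are close in total variation as soon as
  \<open>\<Sum>j. (\<theta> j - \<eta> j)\<^sup>2\<close> is small (\<open>bernoulli_mass_dist\<close>). What has to be small is a sum of
  squares; the sum of the moduli \<open>\<bar>\<theta> j - \<eta> j\<bar>\<close> may stay of order \<open>1\<close>, as it does below.

  Let \<open>\<theta>\<close> be a tent of height \<open>pi / 2\<close> at \<open>0\<close> whose slopes have length about \<open>n\<close>. At \<open>0\<close> the
  probability is exactly \<open>1\<close>, so \<open>0\<close> always belongs to the random set. A bijection \<open>g\<close> of
  displacement at most \<open>k\<close> transports the law of \<open>\<theta>\<close> to that of \<open>\<theta> \<circ> g\<inverse>\<close>, and \<open>\<theta>\<close> and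
  \<open>\<theta> \<circ> g\<inverse>\<close> differ by \<open>O(k / n)\<close> at \<open>O(n + k)\<close> places. The sum of the squares is thus
  \<open>O(1 / n)\<close> for fixed \<open>g\<close>, and the laws are asymptotically invariant. By Tychonoff's theorem they
  have a pointwise limit along a filter (\<open>bounded_family_filter_limit\<close>), which is the required
  mean.
\<close>

section \<open>Random finite sets with independent members\<close>

definition amplitude :: "('a \<Rightarrow> real) \<Rightarrow> 'a set \<Rightarrow> 'a set \<Rightarrow> real" where
  "amplitude \<theta> F E = (\<Prod>j\<in>E. sin (\<theta> j)) * (\<Prod>j\<in>F - E. cos (\<theta> j))"

text \<open>The law of the random subset of the window \<open>F\<close> that contains each \<open>j\<close> independently with
  probability \<open>sin\<^sup>2 (\<theta> j)\<close>, as a finitely additive function of all families of sets.\<close>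

definition bernoulli_mass :: "('a \<Rightarrow> real) \<Rightarrow> 'a set \<Rightarrow> 'a set set \<Rightarrow> real" where
  "bernoulli_mass \<theta> F A = (\<Sum>E\<in>Pow F \<inter> A. (amplitude \<theta> F E)\<^sup>2)"

text \<open>Both sides are the inner product of the tensor products over \<open>F\<close> of the unit vectors
  \<open>(cos (\<theta> j), sin (\<theta> j))\<close> and \<open>(cos (\<eta> j), sin (\<eta> j))\<close>.\<close>

lemma amplitude_inner_product:
  assumes "finite F"
  shows "(\<Sum>E\<in>Pow F. amplitude \<theta> F E * amplitude \<eta> F E) = (\<Prod>j\<in>F. cos (\<theta> j - \<eta> j))"
proof -
  have "(\<Prod>j\<in>F. cos (\<theta> j - \<eta> j)) =
      (\<Prod>j\<in>F. sin (\<theta> j) * sin (\<eta> j) + cos (\<theta> j) * cos (\<eta> j))"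
    by (simp add: cos_diff add.commute)
  also have "\<dots> = (\<Sum>E\<in>Pow F. amplitude \<theta> F E * amplitude \<eta> F E)"
    by (simp add: prod_add[OF assms] amplitude_def prod.distrib mult_ac)
  finally show ?thesis by simp
qed

lemma sum_amplitude_squared:
  assumes "finite F"
  shows "(\<Sum>E\<in>Pow F. (amplitude \<theta> F E)\<^sup>2) = 1"
  using amplitude_inner_product[OF assms, of \<theta> \<theta>] by (simp add: power2_eq_square)

lemma bernoulli_mass_nonneg: "0 \<le> bernoulli_mass \<theta> F A"
  by (simp add: bernoulli_mass_def sum_nonneg)

lemma bernoulli_mass_superset_Pow:
  assumes "finite F" "Pow F \<subseteq> A"
  shows "bernoulli_mass \<theta> F A = 1"
proof -
  have "Pow F \<inter> A = Pow F" using assms(2) by blast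
  then show ?thesis by (simp add: bernoulli_mass_def sum_amplitude_squared[OF assms(1)])
qed

lemma bernoulli_mass_le_1:
  assumes "finite F"
  shows "bernoulli_mass \<theta> F A \<le> 1"
proof -
  have "bernoulli_mass \<theta> F A \<le> (\<Sum>E\<in>Pow F. (amplitude \<theta> F E)\<^sup>2)"
    unfolding bernoulli_mass_def using assms by (intro sum_mono2) auto
  then show ?thesis by (simp add: sum_amplitude_squared[OF assms])
qed

lemma bernoulli_mass_Un:
  assumes "finite F" "A \<inter> B = {}"
  shows "bernoulli_mass \<theta> F (A \<union> B) = bernoulli_mass \<theta> F A + bernoulli_mass \<theta> F B"
  unfolding bernoulli_mass_def Int_Un_distrib
  by (rule sum.union_disjoint) (use assms in auto)

lemma bernoulli_mass_certain_member:
  assumes "finite F" "a \<in> F" "cos (\<theta> a) = 0"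
  shows "bernoulli_mass \<theta> F {E \<in> Fpow UNIV. a \<in> E} = 1"
proof -
  have "amplitude \<theta> F E = 0" if "a \<notin> E" for E
    using that assms by (auto simp: amplitude_def)
  then have "bernoulli_mass \<theta> F {E \<in> Fpow UNIV. a \<in> E} = (\<Sum>E\<in>Pow F. (amplitude \<theta> F E)\<^sup>2)"
    unfolding bernoulli_mass_def
    by (intro sum.mono_neutral_left) (use assms(1) in \<open>auto simp: Fpow_def finite_subset\<close>)
  then show ?thesis by (simp add: sum_amplitude_squared[OF assms(1)])
qed

text \<open>Points where the angle vanishes are never chosen, so only the support of \<open>\<theta>\<close> matters. This
  lets two laws with different supports be compared on a common window.\<close>

lemma bernoulli_mass_enlarge_window:
  assumes "finite F'" "F \<subseteq> F'" "\<And>j. j \<notin> F \<Longrightarrow> \<theta> j = 0"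
  shows "bernoulli_mass \<theta> F' A = bernoulli_mass \<theta> F A"
proof -
  have outside: "amplitude \<theta> F' E = 0" if E: "E \<in> Pow F' \<inter> A - Pow F \<inter> A" for E
  proof -
    obtain j where "j \<in> E" "j \<notin> F" using E by blast
    moreover have "finite E" using E assms(1) finite_subset by blast
    ultimately have "(\<Prod>j\<in>E. sin (\<theta> j)) = 0" using assms(3)[of j] by (auto simp: prod_zero_iff intro!: bexI[of _ j])
    then show ?thesis by (simp add: amplitude_def)
  qed
  have inside: "amplitude \<theta> F' E = amplitude \<theta> F E" if "E \<in> Pow F" for E
  proof -
    have "(\<Prod>j\<in>F - E. cos (\<theta> j)) = (\<Prod>j\<in>F' - E. cos (\<theta> j))"
    proof (rule prod.mono_neutral_left)
      show "\<forall>j\<in>F' - E - (F - E). cos (\<theta> j) = 1"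
      proof
        fix j assume "j \<in> F' - E - (F - E)"
        then have "\<theta> j = 0" by (intro assms(3)) blast
        then show "cos (\<theta> j) = 1" by simp
      qed
    qed (use assms in auto)
    then show ?thesis by (simp add: amplitude_def)
  qed
  have "bernoulli_mass \<theta> F' A = (\<Sum>E\<in>Pow F \<inter> A. (amplitude \<theta> F' E)\<^sup>2)"
    unfolding bernoulli_mass_def
    by (rule sum.mono_neutral_right) (use assms outside in auto)
  also have "\<dots> = bernoulli_mass \<theta> F A"
    unfolding bernoulli_mass_def by (rule sum.cong) (auto simp: inside)
  finally show ?thesis .
qed

lemma bernoulli_mass_image:
  assumes "bij g"
  shows "bernoulli_mass (\<theta> \<circ> inv_into UNIV g) (g ` F) ((`) g ` A) = bernoulli_mass \<theta> F A"
proof -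
  have inj: "inj g" using assms by (rule bij_is_inj)
  have amp: "amplitude (\<theta> \<circ> inv_into UNIV g) (g ` F) (g ` E) = amplitude \<theta> F E" for E
    using inj by (simp add: amplitude_def image_set_diff[OF inj, symmetric] prod.reindex inj_on_def)
  have "Pow (g ` F) \<inter> (`) g ` A = (`) g ` (Pow F \<inter> A)"
    using inj by (auto simp: inj_image_subset_iff)
  moreover have "inj_on ((`) g) (Pow F \<inter> A)"
    using inj by (auto simp: inj_on_def inj_image_eq_iff)
  ultimately show ?thesis
    by (simp add: bernoulli_mass_def sum.reindex amp)
qed

text \<open>If \<open>a\<close> and \<open>b\<close> are the amplitudes and \<open>c\<close> is their inner product, then the Cauchy-Schwarz
  inequality for \<open>a\<^sup>2 - b\<^sup>2 = (a - b) * (a + b)\<close> bounds the squared distance of the laws by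
  \<open>(2 - 2 * c) * (2 + 2 * c) = 4 * (1 - c\<^sup>2)\<close>. As \<open>c\<^sup>2\<close> is the product of the numbers
  \<open>1 - sin\<^sup>2 (\<theta> j - \<eta> j)\<close>, it differs from \<open>1\<close> by at most the sum of the squared sines.\<close>

lemma bernoulli_mass_dist:
  assumes F: "finite F"
  shows "(bernoulli_mass \<theta> F A - bernoulli_mass \<eta> F A)\<^sup>2 \<le> 4 * (\<Sum>j\<in>F. (\<theta> j - \<eta> j)\<^sup>2)"
proof -
  define a where "a = amplitude \<theta> F"
  define b where "b = amplitude \<eta> F"
  define c where "c = (\<Prod>j\<in>F. cos (\<theta> j - \<eta> j))"
  have a: "(\<Sum>E\<in>Pow F. (a E)\<^sup>2) = 1" and b: "(\<Sum>E\<in>Pow F. (b E)\<^sup>2) = 1"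
    by (simp_all add: a_def b_def sum_amplitude_squared[OF F])
  have ab: "(\<Sum>E\<in>Pow F. a E * b E) = c"
    by (simp add: a_def b_def c_def amplitude_inner_product[OF F])
  have minus: "(\<Sum>E\<in>Pow F. \<bar>a E - b E\<bar>\<^sup>2) = 2 - 2 * c"
    using a b ab
    by (simp add: power2_diff sum.distrib sum_subtractf mult.assoc flip: sum_distrib_left)
  have plus: "(\<Sum>E\<in>Pow F. \<bar>a E + b E\<bar>\<^sup>2) = 2 + 2 * c"
    using a b ab
    by (simp add: power2_sum sum.distrib mult.assoc flip: sum_distrib_left)
  have "\<bar>bernoulli_mass \<theta> F A - bernoulli_mass \<eta> F A\<bar> = \<bar>\<Sum>E\<in>Pow F \<inter> A. (a E)\<^sup>2 - (b E)\<^sup>2\<bar>"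
    by (simp add: bernoulli_mass_def a_def b_def sum_subtractf)
  also have "\<dots> \<le> (\<Sum>E\<in>Pow F \<inter> A. \<bar>(a E)\<^sup>2 - (b E)\<^sup>2\<bar>)"
    by (rule sum_abs)
  also have "\<dots> \<le> (\<Sum>E\<in>Pow F. \<bar>(a E)\<^sup>2 - (b E)\<^sup>2\<bar>)"
    using F by (intro sum_mono2) auto
  also have "\<dots> = (\<Sum>E\<in>Pow F. \<bar>a E - b E\<bar> * \<bar>a E + b E\<bar>)"
    by (simp add: power2_eq_square square_diff_square_factored abs_mult mult.commute)
  finally have "\<bar>bernoulli_mass \<theta> F A - bernoulli_mass \<eta> F A\<bar>\<^sup>2 \<le>
      (\<Sum>E\<in>Pow F. \<bar>a E - b E\<bar> * \<bar>a E + b E\<bar>)\<^sup>2"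
    by (rule power_mono) simp
  also have "\<dots> \<le> (2 - 2 * c) * (2 + 2 * c)"
    using Cauchy_Schwarz_ineq_sum[of "\<lambda>E. \<bar>a E - b E\<bar>" "\<lambda>E. \<bar>a E + b E\<bar>" "Pow F"]
    by (simp only: minus plus)
  also have "\<dots> = 4 * (1 - c\<^sup>2)"
    by (simp add: power2_eq_square algebra_simps)
  also have "c\<^sup>2 = (\<Prod>j\<in>F. 1 - (sin (\<theta> j - \<eta> j))\<^sup>2)"
    by (simp add: c_def prod_power_distrib cos_squared_eq)
  also have "1 - \<dots> \<le> (\<Sum>j\<in>F. (sin (\<theta> j - \<eta> j))\<^sup>2)"
    using Weierstrass_prod_ineq[of F "\<lambda>j. (sin (\<theta> j - \<eta> j))\<^sup>2"]
    by (simp add: abs_square_le_1)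
  also have "\<dots> \<le> (\<Sum>j\<in>F. (\<theta> j - \<eta> j)\<^sup>2)"
    by (intro sum_mono) (simp add: abs_le_square_iff[symmetric] abs_sin_x_le_abs_x)
  finally show ?thesis by simp
qed

section \<open>Limits along a filter\<close>

text \<open>The index \<open>x\<close> may range over an uncountable type, so a convergent subsequence need not
  exist. By compactness of the product of the intervals the sequence still has a cluster point \<open>l\<close>,
  and the indices \<open>n\<close> with \<open>f n\<close> close to \<open>l\<close> generate the filter.\<close>

lemma bounded_family_filter_limit:
  fixes f :: "nat \<Rightarrow> 'b \<Rightarrow> real"
  assumes "\<And>n x. f n x \<in> {0..1}"
  obtains \<F> l where "\<F> \<noteq> bot" "\<F> \<le> sequentially" "\<And>x. ((\<lambda>n. f n x) \<longlongrightarrow> l x) \<F>"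
proof -
  define K :: "('b \<Rightarrow> real) set" where "K = Pi\<^sub>E UNIV (\<lambda>_. {0..1})"
  have "compactin (product_topology (\<lambda>_. euclidean) UNIV) K"
    unfolding K_def compactin_PiE by simp
  then have "compact K"
    by (simp add: euclidean_product_topology)
  moreover have "filtermap f sequentially \<noteq> bot"
    by (simp add: filtermap_bot_iff)
  moreover have "eventually (\<lambda>h. h \<in> K) (filtermap f sequentially)"
    using assms by (auto simp: eventually_filtermap K_def PiE_def)
  ultimately obtain l where l: "inf (nhds l) (filtermap f sequentially) \<noteq> bot"
    unfolding compact_filter by blast
  define \<F> where "\<F> = inf (filtercomap f (nhds l)) sequentially"
  show thesis
  proof
    show "\<F> \<noteq> bot"
    proof
      assume "\<F> = bot"
      then have "eventually (\<lambda>_. False) \<F>" by simp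
      then obtain P Q where PQ: "eventually P (nhds l)" "eventually Q sequentially"
          "\<And>n. P (f n) \<Longrightarrow> Q n \<Longrightarrow> False"
        unfolding \<F>_def eventually_inf eventually_filtercomap by blast
      have "eventually (\<lambda>h. \<not> P h) (filtermap f sequentially)"
        unfolding eventually_filtermap using PQ(2) by eventually_elim (use PQ(3) in blast)
      then have "eventually (\<lambda>_. False) (inf (nhds l) (filtermap f sequentially))"
        unfolding eventually_inf using PQ(1) by blast
      then show False using l by (simp add: eventually_False)
    qed
    show "\<F> \<le> sequentially" by (simp add: \<F>_def)
    show "((\<lambda>n. f n x) \<longlongrightarrow> l x) \<F>" for x
    proof -
      have "filterlim f (nhds l) \<F>"
        unfolding \<F>_def by (rule filterlim_mono[OF filterlim_filtercomap order_refl inf_le1])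
      then show ?thesis
        by (rule continuous_on_tendsto_compose[OF continuous_on_product_coordinates]) auto
    qed
  qed
qed

section \<open>Tents\<close>

definition tent :: "nat \<Rightarrow> int \<Rightarrow> real" where
  "tent n j = pi / 2 * max 0 (1 - \<bar>real_of_int j\<bar> / real (Suc n))"

definition tent_mass :: "nat \<Rightarrow> int set set \<Rightarrow> real" where
  "tent_mass n = bernoulli_mass (tent n) {- int n..int n}"

lemma tent_outside: "j \<notin> {- int n..int n} \<Longrightarrow> tent n j = 0"
proof -
  assume "j \<notin> {- int n..int n}"
  then have "int (Suc n) \<le> \<bar>j\<bar>" by auto
  then have "real (Suc n) \<le> \<bar>real_of_int j\<bar>" by linarith
  then show ?thesis by (simp add: tent_def field_simps)
qed

lemma tent_lipschitz:
  "\<bar>tent n i - tent n j\<bar> \<le> pi / 2 * (\<bar>real_of_int (i - j)\<bar> / real (Suc n))"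
proof -
  have "\<bar>max 0 (1 - \<bar>real_of_int i\<bar> / real (Suc n)) - max 0 (1 - \<bar>real_of_int j\<bar> / real (Suc n))\<bar>
      \<le> \<bar>\<bar>real_of_int i\<bar> / real (Suc n) - \<bar>real_of_int j\<bar> / real (Suc n)\<bar>"
    by linarith
  also have "\<dots> = \<bar>\<bar>real_of_int i\<bar> - \<bar>real_of_int j\<bar>\<bar> / real (Suc n)"
    by (simp add: diff_divide_distrib[symmetric])
  also have "\<dots> \<le> \<bar>real_of_int (i - j)\<bar> / real (Suc n)"
    by (intro divide_right_mono) linarith+
  finally have "pi / 2 * \<bar>max 0 (1 - \<bar>real_of_int i\<bar> / real (Suc n)) -
        max 0 (1 - \<bar>real_of_int j\<bar> / real (Suc n))\<bar>
      \<le> pi / 2 * (\<bar>real_of_int (i - j)\<bar> / real (Suc n))"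
    by (rule mult_left_mono) simp
  then show ?thesis
    unfolding tent_def right_diff_distrib[symmetric] abs_mult by simp
qed

text \<open>The constant bounds four times the number \<open>2 * (n + k) + 1\<close> of points in the window
  \<open>{- (n + k)..n + k}\<close>, which contains the supports of the tent and of its transport by \<open>g\<close>, times
  the square of the largest possible change \<open>pi / 2 * k / (n + 1)\<close> of the angle at a point.\<close>

lemma tent_mass_almost_invariant:
  assumes "bij g" and k: "\<And>j. \<bar>g j - j\<bar> \<le> int k"
  shows "(tent_mass n ((`) g ` A) - tent_mass n A)\<^sup>2 \<le>
    4 * ((2 * (real n + real k) + 1) * (pi / 2 * (real k / real (Suc n)))\<^sup>2)"
proof -
  define F where "F = {- int n..int n}"
  define F' where "F' = {- int (n + k)..int (n + k)}"
  define \<eta> where "\<eta> = tent n \<circ> inv_into UNIV g"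
  have inv_k: "\<bar>j - inv_into UNIV g j\<bar> \<le> int k" for j
    using k[of "inv_into UNIV g j"] assms(1) by (simp add: bij_is_surj surj_f_inv_f)
  have "g ` F \<subseteq> F'"
  proof
    fix i assume "i \<in> g ` F"
    then obtain j where "i = g j" "\<bar>j\<bar> \<le> int n" by (auto simp: F_def)
    then show "i \<in> F'" using k[of j] by (auto simp: F'_def)
  qed
  moreover have "\<eta> j = 0" if "j \<notin> g ` F" for j
  proof -
    have "inv_into UNIV g j \<notin> F"
    proof
      assume "inv_into UNIV g j \<in> F"
      then have "g (inv_into UNIV g j) \<in> g ` F" by (rule imageI)
      then show False using that assms(1) by (simp add: bij_is_surj surj_f_inv_f)
    qed
    then show ?thesis by (simp add: \<eta>_def F_def tent_outside)
  qed
  ultimately have "bernoulli_mass \<eta> F' ((`) g ` A) = bernoulli_mass \<eta> (g ` F) ((`) g ` A)"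
    by (intro bernoulli_mass_enlarge_window) (auto simp: F'_def)
  then have transported: "bernoulli_mass \<eta> F' ((`) g ` A) = tent_mass n A"
    using bernoulli_mass_image[OF assms(1)] by (simp add: \<eta>_def tent_mass_def F_def)
  have enlarged: "bernoulli_mass (tent n) F' ((`) g ` A) = tent_mass n ((`) g ` A)"
    unfolding tent_mass_def
    by (rule bernoulli_mass_enlarge_window) (auto simp: F'_def tent_outside)
  have "(tent_mass n ((`) g ` A) - tent_mass n A)\<^sup>2 \<le> 4 * (\<Sum>j\<in>F'. (tent n j - \<eta> j)\<^sup>2)"
    using bernoulli_mass_dist[of F' "tent n" "(`) g ` A" \<eta>]
    unfolding transported enlarged by (simp add: F'_def)
  also have "(\<Sum>j\<in>F'. (tent n j - \<eta> j)\<^sup>2) \<le> (\<Sum>j\<in>F'. (pi / 2 * (real k / real (Suc n)))\<^sup>2)"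
  proof (rule sum_mono)
    fix j
    have "\<bar>real_of_int (j - inv_into UNIV g j)\<bar> \<le> real k"
      using inv_k[of j] by linarith
    then have "pi / 2 * (\<bar>real_of_int (j - inv_into UNIV g j)\<bar> / real (Suc n)) \<le>
        pi / 2 * (real k / real (Suc n))"
      by (intro mult_left_mono divide_right_mono) auto
    then have "\<bar>tent n j - \<eta> j\<bar> \<le> pi / 2 * (real k / real (Suc n))"
      using tent_lipschitz[of n j "inv_into UNIV g j"] by (simp add: \<eta>_def)
    then have "\<bar>tent n j - \<eta> j\<bar>\<^sup>2 \<le> (pi / 2 * (real k / real (Suc n)))\<^sup>2"
      by (rule power_mono) simp
    then show "(tent n j - \<eta> j)\<^sup>2 \<le> (pi / 2 * (real k / real (Suc n)))\<^sup>2"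
      by simp
  qed
  also have "\<dots> = (2 * (real n + real k) + 1) * (pi / 2 * (real k / real (Suc n)))\<^sup>2"
    by (simp add: F'_def algebra_simps)
  finally show ?thesis by simp
qed

lemma tent_mass_asymptotically_invariant:
  assumes "bij g" "\<And>j. \<bar>g j - j\<bar> \<le> int k"
  shows "(\<lambda>n. tent_mass n ((`) g ` A) - tent_mass n A) \<longlonglongrightarrow> 0"
proof -
  have "(\<lambda>n. 4 * ((2 * (real n + real k) + 1) * (pi / 2 * (real k / real (Suc n)))\<^sup>2)) \<longlonglongrightarrow> 0"
  proof -
    have "(\<lambda>n. (2 * (real n + real k) + 1) / (real (Suc n))\<^sup>2) \<longlonglongrightarrow> 0"
      by real_asymp
    then have "(\<lambda>n. 4 * (pi / 2 * real k)\<^sup>2 *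
        ((2 * (real n + real k) + 1) / (real (Suc n))\<^sup>2)) \<longlonglongrightarrow> 0"
      by (rule tendsto_mult_right_zero)
    moreover have "4 * (a * (c * (b / s))\<^sup>2) = 4 * (c * b)\<^sup>2 * (a / s\<^sup>2)" for a b c s :: real
      by (simp add: power_divide power_mult_distrib)
    ultimately show ?thesis by (simp only:)
  qed
  then have "(\<lambda>n. (tent_mass n ((`) g ` A) - tent_mass n A)\<^sup>2) \<longlonglongrightarrow> 0"
  proof (rule tendsto_sandwich[OF _ _ tendsto_const, rotated 2])
    show "\<forall>\<^sub>F n in sequentially. (tent_mass n ((`) g ` A) - tent_mass n A)\<^sup>2 \<le>
        4 * ((2 * (real n + real k) + 1) * (pi / 2 * (real k / real (Suc n)))\<^sup>2)"
      by (rule always_eventually, rule allI, rule tent_mass_almost_invariant[OF assms])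
  qed simp
  then show ?thesis by simp
qed

section \<open>The invariant mean\<close>

theorem theorem3:
  shows "\<exists>m :: int set set \<Rightarrow> real.
    invariant_mean wobbling_group (Fpow UNIV) finite_set_action m \<and>
    m {E \<in> Fpow UNIV. 0 \<in> E} = 1"
proof -
  have "tent_mass n A \<in> {0..1}" for n A
    by (simp add: tent_mass_def bernoulli_mass_nonneg bernoulli_mass_le_1)
  then obtain \<F> m where nontrivial: "\<F> \<noteq> bot" and \<F>: "\<F> \<le> sequentially"
      and m: "\<And>A. ((\<lambda>n. tent_mass n A) \<longlongrightarrow> m A) \<F>"
    using bounded_family_filter_limit[of tent_mass] by blast
  have m_eqI: "m A = x" if "\<And>n. tent_mass n A = x" for A x
    using tendsto_unique[OF nontrivial m[of A]] that by simp
  have "m (Fpow UNIV) = 1"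
    by (rule m_eqI) (auto simp: tent_mass_def Fpow_def finite_subset
        intro!: bernoulli_mass_superset_Pow)
  moreover have "0 \<le> m A" for A
    by (rule tendsto_lowerbound[OF m _ nontrivial])
      (simp add: tent_mass_def bernoulli_mass_nonneg)
  moreover have "m (A \<union> B) = m A + m B" if "A \<inter> B = {}" for A B
  proof (rule tendsto_unique[OF nontrivial m])
    show "((\<lambda>n. tent_mass n (A \<union> B)) \<longlongrightarrow> m A + m B) \<F>"
      using tendsto_add[OF m[of A] m[of B]] that
      by (simp add: tent_mass_def bernoulli_mass_Un)
  qed
  ultimately have "mean_on (Fpow UNIV) m"
    by (simp add: mean_on_def Measure_Space.additive_def)
  moreover have "m (finite_set_action g ` A) = m A"
    if g_mem: "g \<in> carrier wobbling_group" and A: "A \<subseteq> Fpow UNIV" for g A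
  proof -
    obtain k where g: "bij g" "\<And>j. \<bar>g j - j\<bar> \<le> int k"
      using g_mem by (auto simp: wobbling_group_def wobbling_norm_finite_iff simp del: enat_ord_simps)
    have "((\<lambda>n. tent_mass n ((`) g ` A) - tent_mass n A) \<longlongrightarrow> 0) \<F>"
      using tent_mass_asymptotically_invariant[OF g] \<F> by (rule tendsto_mono[rotated])
    then have "m ((`) g ` A) - m A = 0"
      using tendsto_unique[OF nontrivial tendsto_diff[OF m m]] by blast
    moreover have "finite_set_action g ` A = (`) g ` A"
      using A by (intro image_cong) (auto simp: finite_set_action_def)
    ultimately show ?thesis by simp
  qed
  ultimately have "invariant_mean wobbling_group (Fpow UNIV) finite_set_action m"
    by (simp add: invariant_mean_def)
  moreover have "m {E \<in> Fpow UNIV. 0 \<in> E} = 1"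
    by (rule m_eqI) (auto simp: tent_mass_def tent_def intro!: bernoulli_mass_certain_member)
  ultimately show ?thesis by blast
qed

end
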